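(* Let $A\in\mathbb{F}^{n\times n}$ be nonsingular with at most $m$ nonzero entries per row, let $B\in\mathbb{F}^{n\times s}$ with $\|B\|=1$, and let $X_0=O$, $R_0=B$. Let $X_k\in\mathbb{F}^{n\times s}$ and $R_k\in\mathbb{F}^{n\times s}$ ($k\ge1$) be the $k$th (primary) approximation and residual, respectively, generated by the cross-interactive residual smoothing (CIRS) algorithm (described in the context) in finite precision arithmetic, and let $\hat Y_j$, $\hat S_j$ be the approximations and smoothed residuals generated by the same algorithm. Then the norm of the residual gap $G_{R_k}:=(B-AX_k)-R_k$ is bounded, up to terms of order $O(\mathbf{u}^2)$, by $$\|G_{R_k}\|\le k(5+2m)\,\mathbf{u}\,\|A\|\max_{0<j\le k}\|\hat Y_j\|+5(k+1)\,\mathbf{u}\max_{0\le j\le k}\|\hat S_j\|+(2+m)\,\mathbf{u}\,\|A\|\,\|X_k\|+2\,\mathbf{u}\,\|R_k\|.$$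
   Context: $\mathbb{F}\subset\mathbb{R}$ is the set of floating point numbers, $\mathrm{fl}(\cdot)$ denotes the result of a floating point computation, $\mathbf{u}$ is the unit roundoff, $\langle X,Y\rangle_F=\mathrm{tr}(X^\top Y)$, $\|\cdot\|$ is the Frobenius norm, and $m$ is the maximum number of nonzero entries per row of $A$. Here $s\ll n$. CIRS algorithm. Given $X_0$ and $R_0=B-AX_0$, set $\hat Y_0:=X_0$, $\hat S_0:=R_0$, $\hat V_0:=O$, $\hat\eta_0:=0$. For $k=0,1,2,\dots$: (1) compute a direction matrix $\hat P_k$ (corresponding to $X_{k+1}-X_k$) by the primary iterative method for $AX=B$; if the primary method updates $X_{k+1}=X_k+\alpha_kP_k$ with a scalar $\alpha_k$, or $X_{k+1}=X_k+P_k\alpha_k^\square$ with an $s\times s$ matrix $\alpha_k^\square$, then $\hat P_k$ is $\alpha_kP_k$ or $P_k\alpha_k^\square$, respectively; (2) $\hat V_{k+1}=(1-\hat\eta_k)\hat V_k+\hat P_k$; (3) $\hat U_{k+1}=A\hat V_{k+1}$, computed by an explicit multiplication by $A$; (4) $\hat\eta_{k+1}=\langle\hat S_k,\hat U_{k+1}\rangle_F/\langle\hat U_{k+1},\hat U_{k+1}\rangle_F$; (5) $\hat Y_{k+1}=\hat Y_k+\hat\eta_{k+1}\hat V_{k+1}$, $\hat S_{k+1}=\hat S_k-\hat\eta_{k+1}\hat U_{k+1}$; (6) $X_{k+1}=\hat Y_{k+1}+(1-\hat\eta_{k+1})\hat V_{k+1}$, $R_{k+1}=\hat S_{k+1}-(1-\hat\eta_{k+1})\hat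 U_{k+1}$, which are returned to the primary method. It is understood that the algorithm does not break down. Rounding model, for $P,Q\in\mathbb{F}^{n\times s}$ and $\alpha\in\mathbb{F}$: $\mathrm{fl}(P+Q)=P+Q+E'$ with $\|E'\|\le\mathbf{u}(\|P\|+\|Q\|)$; $\mathrm{fl}(\alpha P)=\alpha P+E''$ with $\|E''\|\le\mathbf{u}\|\alpha P\|$; $\mathrm{fl}(AP)=AP+E'''$ with $\|E'''\|\le m\mathbf{u}\|A\|\|P\|$. Subtraction is treated like addition. Convention: terms of $O(\mathbf{u}^2)$ are omitted, and $\mathbf{u}\|\mathrm{fl}(\ast)\|$ is regarded as $\mathbf{u}\|\ast\|$. In finite precision arithmetic all quantities denote computed values; in particular $\hat U_{k+1}=\mathrm{fl}(A\hat V_{k+1})$, $\hat Y_{k+1}=\mathrm{fl}(\hat Y_k+\mathrm{fl}(\hat\eta_{k+1}\hat V_{k+1}))$, $\hat S_{k+1}=\mathrm{fl}(\hat S_k-\mathrm{fl}(\hat\eta_{k+1}\hat U_{k+1}))$, and, with the single computed scalar $\hat\zeta_{k+1}:=\mathrm{fl}(1-\hat\eta_{k+1})$ used in both formulas, $X_{k+1}=\mathrm{fl}(\hat Y_{k+1}+\mathrm{fl}(\hat\zeta_{k+1}\hat V_{k+1}))$, $R_{k+1}=\mathrm{fl}(\hat S_{k+1}-\mathrm{fl}(\hat\zeta_{k+1}\hat U_{k+1}))$. In the definition of $G_{R_k}$ the expression $(B-AX_k)-R_k$ is evaluated exactly. *)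

theory Defs
  imports "HOL-Analysis.Analysis" "HOL-Library.Landau_Symbols"
begin

definition frob_inner :: "real^'s^'n \<Rightarrow> real^'s^'n \<Rightarrow> real" where
  "frob_inner X Y = trace (transpose X ** Y)"

text \<open>The library norm on \<^typ>\<open>real^'s^'n\<close> is the Frobenius norm.\<close>

lemma norm_eq_sqrt_frob_inner: "norm X = sqrt (frob_inner X X)"
  for X :: "real^'s^'n"
proof -
  have "frob_inner X X = (\<Sum>j\<in>UNIV. \<Sum>i\<in>UNIV. X $ i $ j * X $ i $ j)"
    by (simp add: frob_inner_def trace_def matrix_matrix_mult_def transpose_def)
  also have "\<dots> = (\<Sum>i\<in>UNIV. \<Sum>j\<in>UNIV. X $ i $ j * X $ i $ j)"
    by (rule sum.swap)
  also have "\<dots> = inner X X"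
    by (simp add: inner_vec_def)
  finally show ?thesis
    by (simp add: norm_eq_sqrt_inner)
qed

definition mats :: "real set \<Rightarrow> (real^'s^'n) set" where
  "mats F = {X. \<forall>i j. X $ i $ j \<in> F}"

text \<open>
  Rounding model with floating point numbers \<open>F\<close> and unit roundoff \<open>u\<close>. Each of the following
  is the set of all matrices admissible as the computed value fl(.) of the operation; a concrete
  arithmetic returns one element of it. In \<open>fl_mult\<close>, \<open>m\<close> bounds the number of nonzero entries
  per row of \<open>A\<close>.
\<close>

definition fl_add :: "real set \<Rightarrow> real \<Rightarrow> real^'s^'n \<Rightarrow> real^'s^'n \<Rightarrow> (real^'s^'n) set" where
  "fl_add F u P Q = {Z \<in> mats F. norm (Z - (P + Q)) \<le> u * (norm P + norm Q)}"

definition fl_sub :: "real set \<Rightarrow> real \<Rightarrow> real^'s^'n \<Rightarrow> real^'s^'n \<Rightarrow> (real^'s^'n) set" where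
  "fl_sub F u P Q = {Z \<in> mats F. norm (Z - (P - Q)) \<le> u * (norm P + norm Q)}"

definition fl_scale :: "real set \<Rightarrow> real \<Rightarrow> real \<Rightarrow> real^'s^'n \<Rightarrow> (real^'s^'n) set" where
  "fl_scale F u \<alpha> P = {Z \<in> mats F. norm (Z - \<alpha> *\<^sub>R P) \<le> u * norm (\<alpha> *\<^sub>R P)}"

definition fl_mult ::
  "real set \<Rightarrow> real \<Rightarrow> nat \<Rightarrow> real^'n^'n \<Rightarrow> real^'s^'n \<Rightarrow> (real^'s^'n) set" where
  "fl_mult F u m A P = {Z \<in> mats F. norm (Z - A ** P) \<le> real m * u * norm A * norm P}"

text \<open>
  The first \<open>k\<close> steps of the CIRS algorithm in finite precision.

  The rounding model contains no error bound for scalar computations. They enter through an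
  arbitrary \<open>fls\<close>, where \<open>fls x\<close> is the set of floating point numbers that may be returned by the
  evaluation of a scalar expression with exact value \<open>x\<close>. Set values are needed because, e.g., a
  computed inner product is not a function of its exact value.

  \<open>\<zeta> j\<close> is the computed \<open>1 - \<eta> j\<close>. The primary method is arbitrary, so that its directions \<open>P j\<close>
  are arbitrary floating point matrices.
\<close>

locale cirs_fp =
  fixes F :: "real set" and u :: real and fls :: "real \<Rightarrow> real set" and m :: nat
    and A :: "real^'n^'n" and X0 R0 :: "real^'s^'n" and k :: nat
    and P V U Y S X R :: "nat \<Rightarrow> real^'s^'n" and \<eta> \<zeta> :: "nat \<Rightarrow> real"
  assumes scalars: "fls x \<subseteq> F"
    and init: "X 0 = X0" "R 0 = R0" "Y 0 = X 0" "S 0 = R 0" "V 0 = 0" "\<eta> 0 = 0"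
    and zeta: "j \<le> k \<Longrightarrow> \<zeta> j \<in> fls (1 - \<eta> j)"
    and direction: "j < k \<Longrightarrow> P j \<in> mats F"
    and step_V: "j < k \<Longrightarrow> \<exists>T \<in> fl_scale F u (\<zeta> j) (V j). V (Suc j) \<in> fl_add F u T (P j)"
    and step_U: "j < k \<Longrightarrow> U (Suc j) \<in> fl_mult F u m A (V (Suc j))"
    and no_breakdown: "j < k \<Longrightarrow> frob_inner (U (Suc j)) (U (Suc j)) \<noteq> 0"
    and step_eta: "j < k \<Longrightarrow>
      \<eta> (Suc j) \<in> fls (frob_inner (S j) (U (Suc j)) / frob_inner (U (Suc j)) (U (Suc j)))"
    and step_Y: "j < k \<Longrightarrow>
      \<exists>T \<in> fl_scale F u (\<eta> (Suc j)) (V (Suc j)). Y (Suc j) \<in> fl_add F u (Y j) T"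
    and step_S: "j < k \<Longrightarrow>
      \<exists>T \<in> fl_scale F u (\<eta> (Suc j)) (U (Suc j)). S (Suc j) \<in> fl_sub F u (S j) T"
    and step_X: "j < k \<Longrightarrow>
      \<exists>T \<in> fl_scale F u (\<zeta> (Suc j)) (V (Suc j)). X (Suc j) \<in> fl_add F u (Y (Suc j)) T"
    and step_R: "j < k \<Longrightarrow>
      \<exists>T \<in> fl_scale F u (\<zeta> (Suc j)) (U (Suc j)). R (Suc j) \<in> fl_sub F u (S (Suc j)) T"

definition residual_gap :: "real^'n^'n \<Rightarrow> real^'s^'n \<Rightarrow> real^'s^'n \<Rightarrow> real^'s^'n \<Rightarrow> real^'s^'n" where
  "residual_gap A B X R = (B - A ** X) - R"

end

theory Submission
  imports Defs
begin

text \<open>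
  The primary pair \<open>(X\<^sub>k, R\<^sub>k)\<close> arises from \<open>(Y\<^sub>k, S\<^sub>k)\<close> by an update of the same shape
  as the smoothing step \<open>(Y\<^sub>j, S\<^sub>j) \<mapsto> (Y\<^sub>j\<^sub>+\<^sub>1, S\<^sub>j\<^sub>+\<^sub>1)\<close>: both add \<open>c V\<close> to the approximation and
  subtract \<open>c U\<close>, with \<open>U \<approx> A V\<close>, from the residual. The exact parts of such an update
  cancel in the residual gap. What is left are rounding errors, proportional to the norms of
  \<open>c V\<close> and \<open>c U\<close>, which up to a factor \<open>1 + O(u)\<close> are at most the sums of the norms before and
  after the update. An update to \<open>(y', s')\<close> from \<open>(y, s)\<close> thus costs, to first order in \<open>u\<close>,
  \<open>\<parallel>A\<parallel> ((3 + m) \<parallel>y\<parallel> + (2 + m) \<parallel>y'\<parallel>) + 3 \<parallel>s\<parallel> + 2 \<parallel>s'\<parallel>\<close>. Since \<open>Y\<^sub>0 = 0\<close>, the first step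
  saves \<open>(3 + m) \<parallel>A\<parallel> max \<parallel>Y\<^sub>j\<parallel>\<close>, which is exactly what the final update of \<open>X\<^sub>k\<close> costs.
\<close>

text \<open>Row \<open>i\<close> of \<open>A ** X\<close> combines the rows of \<open>X\<close> with
  coefficients \<open>A $ i $ l\<close>, so Cauchy-Schwarz bounds it by
  \<open>norm (A $ i) * norm X\<close>. The L2 sum over \<open>i\<close> gives the claim.\<close>

lemma norm_matrix_matrix_mult_le: "norm (A ** X) \<le> norm A * norm X"
  for A :: "real^'m^'n" and X :: "real^'s^'m"
proof -
  have row: "norm ((A ** X) $ i) \<le> norm (A $ i) * norm X" for i
  proof -
    have "(A ** X) $ i = (\<Sum>l\<in>UNIV. (A $ i $ l) *\<^sub>R (X $ l))"
      by (simp add: vec_eq_iff matrix_matrix_mult_def)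
    also have "norm \<dots> \<le> (\<Sum>l\<in>UNIV. \<bar>A $ i $ l\<bar> * norm (X $ l))"
      by (rule order_trans[OF norm_sum]) simp
    also have "\<dots> \<le> L2_set (\<lambda>l. A $ i $ l) UNIV * L2_set (\<lambda>l. norm (X $ l)) UNIV"
      using L2_set_mult_ineq[where f = "\<lambda>l. A $ i $ l" and g = "\<lambda>l. norm (X $ l)" and A = UNIV]
      by simp
    also have "\<dots> = norm (A $ i) * norm X"
      by (simp add: norm_vec_def L2_set_def)
    finally show ?thesis .
  qed
  have "norm (A ** X) \<le> L2_set (\<lambda>i. norm (A $ i) * norm X) UNIV"
    unfolding norm_vec_def[of "A ** X"] by (rule L2_set_mono) (auto intro: row)
  also have "\<dots> = norm A * norm X"
    by (simp add: L2_set_left_distrib norm_vec_def[of A])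
  finally show ?thesis .
qed

lemma linear_matrix_matrix_mult: "linear (\<lambda>X. A ** X)"
  for A :: "real^'m^'n"
  by (rule linearI)
    (simp_all add: vec_eq_iff matrix_matrix_mult_def sum.distrib sum_distrib_left algebra_simps)

text \<open>Here \<open>d\<close> is the exact increment, \<open>t\<close> its rounded value and
  \<open>p'\<close> the rounded sum. As \<open>d\<close> is \<open>p' - p\<close> up to rounding
  errors, errors proportional to \<open>d\<close> can be measured by the iterates.\<close>

lemma norm_increment_le:
  fixes p d t p' :: "'a::real_normed_vector"
  assumes u: "0 \<le> u" "u \<le> 1/8"
    and t: "norm (t - d) \<le> u * norm d"
    and p': "norm (p' - (p + t)) \<le> u * (norm p + norm t)"
  shows "norm t \<le> (1 + u) * norm d"
    and "norm d \<le> (1 + 8 * u) * (norm p + norm p')"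
proof -
  show t_le: "norm t \<le> (1 + u) * norm d"
    using t norm_triangle_sub[of t d] by (simp add: algebra_simps)
  have "d = (p' - p) - (p' - (p + t)) - (t - d)"
    by simp
  then have "norm d \<le> norm (p' - p) + norm (p' - (p + t)) + norm (t - d)"
    by (metis norm_triangle_ineq4 norm_triangle_le_diff add_mono order_refl)
  also have "\<dots> \<le> (norm p + norm p') + u * (norm p + norm t) + u * norm d"
    using norm_triangle_ineq4[of p' p] t p' by linarith
  also have "\<dots> \<le> (norm p + norm p') + u * (norm p + (1 + u) * norm d) + u * norm d"
    using t_le u by (intro add_mono mult_left_mono order_refl) auto
  \<comment> \<open>The error terms containing \<open>norm d\<close> itself are absorbed on the
    left.\<close>
  finally have "norm d * (1 - 2 * u - u * u) \<le> (1 + u) * norm p + norm p'"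
    by (simp add: algebra_simps)
  also have "\<dots> \<le> (1 + u) * (norm p + norm p')"
    using u by (simp add: algebra_simps)
  finally have *: "norm d * (1 - 2 * u - u * u) \<le> (1 + u) * (norm p + norm p')" .
  have uu: "u * u \<le> 1/8 * u" "u * u \<le> 1/8 * (1/8)"
    using u mult_right_mono[of u "1/8" u] by simp_all
  then have pos: "0 < 1 - 2 * u - u * u"
    using u by linarith
  have "u * (u * u) \<le> 1/8 * (1/8 * u)"
    using u uu by (intro mult_mono) auto
  \<comment> \<open>The right side exceeds the left by
    \<open>5 * u - 17 * u\<^sup>2 - 8 * u\<^sup>3\<close>, which is nonnegative for
    \<open>u \<le> 1/8\<close>.\<close>
  then have "1 + u \<le> (1 + 8 * u) * (1 - 2 * u - u * u)"
    using u uu by (simp add: algebra_simps)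
  then have "(1 + u) * (norm p + norm p')
      \<le> (1 + 8 * u) * (1 - 2 * u - u * u) * (norm p + norm p')"
    by (intro mult_right_mono) auto
  with * have "norm d * (1 - 2 * u - u * u)
      \<le> (1 + 8 * u) * (norm p + norm p') * (1 - 2 * u - u * u)"
    by (simp add: mult_ac)
  with pos show "norm d \<le> (1 + 8 * u) * (norm p + norm p')"
    by simp
qed

text \<open>Five local errors enter. In total they contribute
  \<open>u * N * (norm y + (2 + M + u) * norm (c *\<^sub>R v))\<close> and
  \<open>u * (norm s + (2 + u) * norm (c *\<^sub>R w))\<close>; \<open>norm_increment_le\<close>
  then replaces the increments.\<close>

lemma residual_gap_update_le:
  fixes L :: "'a::real_normed_vector \<Rightarrow> 'b::real_normed_vector"
  assumes L: "linear L" "\<And>x. norm (L x) \<le> N * norm x" and N: "0 \<le> N" and M: "0 \<le> M"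
    and u: "0 \<le> u" "u \<le> 1/8"
    and w: "norm (w - L v) \<le> M * u * N * norm v"
    and t: "norm (t - c *\<^sub>R v) \<le> u * norm (c *\<^sub>R v)"
    and y': "norm (y' - (y + t)) \<le> u * (norm y + norm t)"
    and r: "norm (r - c *\<^sub>R w) \<le> u * norm (c *\<^sub>R w)"
    and s': "norm (s' - (s - r)) \<le> u * (norm s + norm r)"
  shows "norm ((b - L y') - s') \<le> norm ((b - L y) - s)
    + u * (N * ((3 + M) * norm y + (2 + M) * norm y') + 3 * norm s + 2 * norm s')
    + (18 + 8 * M) * u\<^sup>2 * (N * (norm y + norm y') + norm s + norm s')"
proof -
  let ?a = "norm (c *\<^sub>R v)" and ?b = "norm (c *\<^sub>R w)"
  \<comment> \<open>Negating \<open>s\<close> and \<open>s'\<close> turns the subtraction into the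
    addition that \<open>norm_increment_le\<close> treats.\<close>
  have "norm ((- s') - ((- s) + r)) = norm (s' - (s - r))"
    by (metis (no_types, opaque_lifting) minus_diff_eq norm_minus_cancel
        add.commute diff_conv_add_uminus minus_add_distrib minus_minus)
  then have s'': "norm ((- s') - ((- s) + r)) \<le> u * (norm (- s) + norm r)"
    using s' by simp
  note y_incr = norm_increment_le[OF u t y']
  note s_incr = norm_increment_le[OF u r s'', unfolded norm_minus_cancel]
  have "(b - L y') - s' = ((b - L y) - s)
      - (L (t - c *\<^sub>R v) + L (y' - (y + t)))
      + (c *\<^sub>R (w - L v) + (r - c *\<^sub>R w) - (s' - (s - r)))"
    by (simp add: linear_diff[OF L(1)] linear_add[OF L(1)] linear_scale[OF L(1)] algebra_simps)
  also have "norm \<dots> \<le> norm ((b - L y) - s) + (norm (L (t - c *\<^sub>R v)) + norm (L (y' - (y + t))))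
      + (norm (c *\<^sub>R (w - L v)) + norm (r - c *\<^sub>R w) + norm (s' - (s - r)))"
    by (intro norm_triangle_mono norm_triangle_le_diff add_mono order_refl norm_triangle_ineq)
  finally have gap: "norm ((b - L y') - s') \<le> norm ((b - L y) - s)
      + (norm (L (t - c *\<^sub>R v)) + norm (L (y' - (y + t))))
      + (norm (c *\<^sub>R (w - L v)) + norm (r - c *\<^sub>R w) + norm (s' - (s - r)))" .
  have e2: "norm (L (t - c *\<^sub>R v)) \<le> N * (u * ?a)"
    by (rule order_trans[OF L(2) mult_left_mono[OF t N]])
  have "u * (norm y + norm t) \<le> u * (norm y + (1 + u) * ?a)"
    using y_incr(1) u by (intro mult_left_mono) auto
  then have e1: "norm (L (y' - (y + t))) \<le> N * (u * (norm y + (1 + u) * ?a))"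
    using y' N by (intro order_trans[OF L(2)] mult_left_mono) auto
  have e5: "norm (c *\<^sub>R (w - L v)) \<le> M * u * N * ?a"
    using mult_left_mono[OF w abs_ge_zero[of c]] by (simp add: mult_ac)
  have "u * (norm s + norm r) \<le> u * (norm s + (1 + u) * ?b)"
    using s_incr(1) u by (intro mult_left_mono) auto
  then have e3: "norm (s' - (s - r)) \<le> u * (norm s + (1 + u) * ?b)"
    using s' by linarith
  \<comment> \<open>Taken with \<open>K = M\<close> for the approximation and \<open>K = 0\<close>
    for the residual. The product has linear coefficient \<open>17 + 8 * K\<close>, and
    \<open>8 * u\<^sup>2 \<le> u\<close> makes it \<open>18 + 8 * K\<close>.\<close>
  have coeff: "(2 + K + u) * (1 + 8 * u) \<le> 2 + K + (18 + 8 * K) * u" if "0 \<le> K" for K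
  proof -
    have "8 * (u * u) \<le> u"
      using u mult_right_mono[of u "1/8" u] by simp
    then show ?thesis
      by (simp add: algebra_simps)
  qed
  have incr: "(2 + K + u) * x \<le> (2 + K + (18 + 8 * K) * u) * z"
    if "0 \<le> K" "0 \<le> z" "x \<le> (1 + 8 * u) * z" for K x z
  proof -
    have "(2 + K + u) * x \<le> (2 + K + u) * ((1 + 8 * u) * z)"
      using that u by (intro mult_left_mono) auto
    also have "\<dots> \<le> (2 + K + (18 + 8 * K) * u) * z"
      using mult_right_mono[OF coeff[OF that(1)] that(2)] by (simp add: mult_ac)
    finally show ?thesis .
  qed
  have "N * u * ((2 + M + u) * ?a) \<le> N * u * ((2 + M + (18 + 8 * M) * u) * (norm y + norm y'))"
    using N u M y_incr(2) by (intro mult_left_mono incr mult_nonneg_nonneg) auto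
  moreover have "u * ((2 + 0 + u) * ?b) \<le> u * ((2 + 0 + (18 + 8 * 0) * u) * (norm s + norm s'))"
    using u s_incr(2) by (intro mult_left_mono incr) auto
  \<comment> \<open>Slack that raises the second-order constant of the residual part from
    \<open>18\<close> to the common \<open>18 + 8 * M\<close>.\<close>
  moreover have "0 \<le> M * (u * u) * (norm s + norm s')"
    using M u by simp
  ultimately show ?thesis
    using gap e1 e2 e3 e5 r by (simp add: algebra_simps power2_eq_square)
qed

context cirs_fp
begin

context
  assumes u: "0 \<le> u" "u \<le> 1/8"
begin

text \<open>\<open>Y\<close> and \<open>S\<close> are updated with the same computed
  \<open>\<eta> (Suc j)\<close>, so the error in computing this scalar cancels in the gap.\<close>

lemma smoothed_gap_step:
  assumes "j < k"
  shows "norm ((C - A ** Y (Suc j)) - S (Suc j)) \<le> norm ((C - A ** Y j) - S j)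
    + u * (norm A * ((3 + real m) * norm (Y j) + (2 + real m) * norm (Y (Suc j)))
        + 3 * norm (S j) + 2 * norm (S (Suc j)))
    + (18 + 8 * real m) * u\<^sup>2
        * (norm A * (norm (Y j) + norm (Y (Suc j))) + norm (S j) + norm (S (Suc j)))"
proof -
  from step_Y[OF assms] step_S[OF assms] obtain T T' where
    "T \<in> fl_scale F u (\<eta> (Suc j)) (V (Suc j))" "Y (Suc j) \<in> fl_add F u (Y j) T"
    "T' \<in> fl_scale F u (\<eta> (Suc j)) (U (Suc j))" "S (Suc j) \<in> fl_sub F u (S j) T'"
    by blast
  with step_U[OF assms] show ?thesis
    by (intro residual_gap_update_le[OF linear_matrix_matrix_mult norm_matrix_matrix_mult_le _ _ u])
      (auto simp: fl_scale_def fl_add_def fl_sub_def fl_mult_def)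
qed

text \<open>The error of the scalar cancels again, since one computed \<open>\<zeta> (Suc j)\<close>
  serves both updates.\<close>

lemma primary_gap_step:
  assumes "j < k"
  shows "norm ((C - A ** X (Suc j)) - R (Suc j)) \<le> norm ((C - A ** Y (Suc j)) - S (Suc j))
    + u * (norm A * ((3 + real m) * norm (Y (Suc j)) + (2 + real m) * norm (X (Suc j)))
        + 3 * norm (S (Suc j)) + 2 * norm (R (Suc j)))
    + (18 + 8 * real m) * u\<^sup>2
        * (norm A * (norm (Y (Suc j)) + norm (X (Suc j))) + norm (S (Suc j)) + norm (R (Suc j)))"
proof -
  from step_X[OF assms] step_R[OF assms] obtain T T' where
    "T \<in> fl_scale F u (\<zeta> (Suc j)) (V (Suc j))" "X (Suc j) \<in> fl_add F u (Y (Suc j)) T"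
    "T' \<in> fl_scale F u (\<zeta> (Suc j)) (U (Suc j))" "R (Suc j) \<in> fl_sub F u (S (Suc j)) T'"
    by blast
  with step_U[OF assms] show ?thesis
    by (intro residual_gap_update_le[OF linear_matrix_matrix_mult norm_matrix_matrix_mult_le _ _ u])
      (auto simp: fl_scale_def fl_add_def fl_sub_def fl_mult_def)
qed

text \<open>The gap is zero at the start, and the costs of \<open>j + 1\<close> smoothing steps add
  up.\<close>

lemma smoothed_gap_le:
  fixes y s :: real
  assumes X0: "X0 = 0"
    and y: "\<And>j. 0 < j \<Longrightarrow> j \<le> k \<Longrightarrow> norm (Y j) \<le> y"
    and s: "\<And>j. j \<le> k \<Longrightarrow> norm (S j) \<le> s"
    and j: "j < k"
  shows "norm ((R0 - A ** Y (Suc j)) - S (Suc j))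
    \<le> u * (norm A * ((real j * (5 + 2 * real m) + (2 + real m)) * y) + 5 * (real j + 1) * s)
      + (18 + 8 * real m) * u\<^sup>2 * (2 * (real j + 1) * (norm A * y + s))"
proof -
  define n where "n = norm A"
  define q where "q = (18 + 8 * real m) * u\<^sup>2"
  have n: "0 \<le> n" and q: "0 \<le> q"
    by (auto simp: n_def q_def)
  have Y0: "Y 0 = 0" and S0: "S 0 = R0"
    using init X0 by auto
  \<comment> \<open>The separate bound \<open>a\<close> on \<open>Y i\<close> lets the first step
    use \<open>a = 0\<close>, later ones \<open>a = y\<close>.\<close>
  have step: "norm ((R0 - A ** Y (Suc i)) - S (Suc i)) \<le> norm ((R0 - A ** Y i) - S i)
      + u * (n * ((3 + real m) * a + (2 + real m) * y) + 5 * s) + q * (n * (a + y) + 2 * s)"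
    if "i < k" "norm (Y i) \<le> a" for i and a :: real
  proof -
    have "norm ((R0 - A ** Y (Suc i)) - S (Suc i)) \<le> norm ((R0 - A ** Y i) - S i)
        + u * (n * ((3 + real m) * norm (Y i) + (2 + real m) * norm (Y (Suc i)))
            + 3 * norm (S i) + 2 * norm (S (Suc i)))
        + q * (n * (norm (Y i) + norm (Y (Suc i))) + norm (S i) + norm (S (Suc i)))"
      using smoothed_gap_step[OF that(1), of R0] by (simp add: n_def q_def)
    also have "\<dots> \<le> norm ((R0 - A ** Y i) - S i)
        + u * (n * ((3 + real m) * a + (2 + real m) * y) + 3 * s + 2 * s) + q * (n * (a + y) + s + s)"
      using that y[of "Suc i"] s[of i] s[of "Suc i"] n q u
      by (intro add_mono mult_left_mono order_refl) auto
    also have "n * ((3 + real m) * a + (2 + real m) * y) + 3 * s + 2 * s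
        = n * ((3 + real m) * a + (2 + real m) * y) + 5 * s"
      by simp
    also have "n * (a + y) + s + s = n * (a + y) + 2 * s"
      by simp
    finally show ?thesis .
  qed
  have "0 \<le> y"
    using order_trans[OF norm_ge_zero y[of "Suc j"]] j by simp
  \<comment> \<open>With \<open>a = 0\<close> the first step yields \<open>q * (n * y)\<close>; this
    slack rounds it up to the uniform \<open>2 * q * (n * y)\<close>.\<close>
  then have ny: "0 \<le> q * (n * y)"
    using n q by simp
  from j have "norm ((R0 - A ** Y (Suc j)) - S (Suc j))
    \<le> u * (n * ((real j * (5 + 2 * real m) + (2 + real m)) * y) + 5 * (real j + 1) * s)
      + q * (2 * (real j + 1) * (n * y + s))"
  proof (induction j)
    case 0
    show ?case
      using step[OF 0, of 0] Y0 S0 ny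
      by (simp add: linear_0[OF linear_matrix_matrix_mult] algebra_simps)
  next
    case (Suc j)
    then have "norm ((R0 - A ** Y (Suc (Suc j))) - S (Suc (Suc j)))
        \<le> (u * (n * ((real j * (5 + 2 * real m) + (2 + real m)) * y) + 5 * (real j + 1) * s)
            + q * (2 * (real j + 1) * (n * y + s)))
          + u * (n * ((3 + real m) * y + (2 + real m) * y) + 5 * s) + q * (n * (y + y) + 2 * s)"
      using step[of "Suc j" y] y[of "Suc j"] by simp
    then show ?case
      by (simp add: algebra_simps)
  qed
  then show ?thesis
    by (simp add: n_def q_def)
qed

end

end

theorem theorem4p3:
  fixes k m :: nat
  assumes "k \<ge> 1"
  shows "\<exists>\<rho>. \<rho> \<in> O[at_right 0](\<lambda>u::real. u\<^sup>2) \<and>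
    (\<forall>\<^sub>F u in at_right 0.
      \<forall>F fls (A :: real^'n^'n) (B :: real^'s^'n) P V U Y S X R \<eta> \<zeta>.
        A \<in> mats F \<and> invertible A \<and> (\<forall>i. card {j. A $ i $ j \<noteq> 0} \<le> m) \<and>
        B \<in> mats F \<and> norm B = 1 \<and>
        cirs_fp F u fls m A 0 B k P V U Y S X R \<eta> \<zeta> \<longrightarrow>
        norm (residual_gap A B (X k) (R k))
          \<le> real k * (5 + 2 * real m) * u * norm A * (MAX j\<in>{0<..k}. norm (Y j))
            + 5 * (real k + 1) * u * (MAX j\<in>{0..k}. norm (S j))
            + (2 + real m) * u * norm A * norm (X k)
            + 2 * u * norm (R k)
            + \<rho> u * (norm A * (MAX j\<in>{0<..k}. norm (Y j)) + (MAX j\<in>{0..k}. norm (S j))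
                      + norm A * norm (X k) + norm (R k)))"
proof -
  \<comment> \<open>Each of the \<open>k\<close> smoothing steps contributes 2 to the factor
    \<open>2 * real k + 1\<close>, the final primary update 1.\<close>
  define \<rho> :: "real \<Rightarrow> real" where "\<rho> u = (18 + 8 * real m) * (2 * real k + 1) * u\<^sup>2" for u
  have rho: "\<rho> \<in> O[at_right 0](\<lambda>u. u\<^sup>2)"
    unfolding \<rho>_def by simp
  have bound: "norm (residual_gap A B (X k) (R k))
      \<le> real k * (5 + 2 * real m) * u * norm A * (MAX j\<in>{0<..k}. norm (Y j))
        + 5 * (real k + 1) * u * (MAX j\<in>{0..k}. norm (S j))
        + (2 + real m) * u * norm A * norm (X k)
        + 2 * u * norm (R k)
        + \<rho> u * (norm A * (MAX j\<in>{0<..k}. norm (Y j)) + (MAX j\<in>{0..k}. norm (S j))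
                  + norm A * norm (X k) + norm (R k))"
    if u: "0 \<le> u" "u \<le> 1/8" and "cirs_fp F u fls m A 0 B k P V U Y S X R \<eta> \<zeta>"
    for u F fls and A :: "real^'n^'n" and B :: "real^'s^'n" and P V U Y S X R \<eta> \<zeta>
  proof -
    interpret cirs_fp F u fls m A 0 B k P V U Y S X R \<eta> \<zeta>
      by fact
    define y where "y = (MAX j\<in>{0<..k}. norm (Y j))"
    define s where "s = (MAX j\<in>{0..k}. norm (S j))"
    define n where "n = norm A"
    define q where "q = (18 + 8 * real m) * u\<^sup>2"
    have n: "0 \<le> n" and q: "0 \<le> q"
      by (auto simp: n_def q_def)
    have y: "norm (Y j) \<le> y" if "0 < j" "j \<le> k" for j
      unfolding y_def using that by (intro Max_ge) auto
    have s: "norm (S j) \<le> s" if "j \<le> k" for j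
      unfolding s_def using that by (intro Max_ge) auto
    have s0: "0 \<le> s"
      using s[of 0] norm_ge_zero order_trans by blast
    obtain j where k: "k = Suc j"
      using assms by (cases k) auto
    have "norm ((B - A ** X k) - R k) \<le> norm ((B - A ** Y k) - S k)
        + u * (n * ((3 + real m) * norm (Y k) + (2 + real m) * norm (X k)) + 3 * norm (S k) + 2 * norm (R k))
        + q * (n * (norm (Y k) + norm (X k)) + norm (S k) + norm (R k))"
      using primary_gap_step[OF u, of j B] by (simp add: k n_def q_def)
    also have "\<dots> \<le> (u * (n * ((real j * (5 + 2 * real m) + (2 + real m)) * y) + 5 * (real j + 1) * s)
          + q * (2 * (real j + 1) * (n * y + s)))
        + u * (n * ((3 + real m) * y + (2 + real m) * norm (X k)) + 3 * s + 2 * norm (R k))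
        + q * (n * (y + norm (X k)) + s + norm (R k))"
      using smoothed_gap_le[OF u refl y s, of j] y[of k] s[of k] n q u k
      by (intro add_mono mult_left_mono order_refl) (auto simp: n_def q_def)
    also have "\<dots> \<le> real k * (5 + 2 * real m) * u * n * y + 5 * (real k + 1) * u * s
        + (2 + real m) * u * n * norm (X k) + 2 * u * norm (R k)
        + q * (2 * real k + 1) * (n * y + s + n * norm (X k) + norm (R k))"
    proof -
      \<comment> \<open>The first-order coefficient of \<open>n * y\<close> is exactly
        \<open>k * (5 + 2 * m)\<close>, while that of \<open>s\<close> is \<open>5 * k + 3\<close>,
        rounded up to \<open>5 * (k + 1)\<close>. The other two products let one factor
        \<open>2 * k + 1\<close> multiply all four norms.\<close>
      have "0 \<le> u * s" "0 \<le> q * k * (n * norm (X k))" "0 \<le> q * k * norm (R k)"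
        using u s0 n q by simp_all
      then show ?thesis
        by (simp add: k algebra_simps)
    qed
    finally show ?thesis
      by (simp add: residual_gap_def \<rho>_def y_def s_def n_def q_def mult_ac)
  qed
  have ev: "\<forall>\<^sub>F u :: real in at_right 0. 0 \<le> u \<and> u \<le> 1/8"
    by (rule eventually_at_rightI[of 0 "1/8"]) auto
  show ?thesis
    by (intro exI[of _ \<rho>] conjI rho eventually_mono[OF ev] allI impI)
      (elim conjE, rule bound)
qed

end
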